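(* Suppose there exists $\mu_Q>0$ such that $J_Q(\theta;Z_Q)J_Q(\theta;Z_Q)^\top\succeq\mu_QI_M$ for every $\theta\in B_Q$. Then there exists a constant $c_{\rm BE}>0$ such that $$\tfrac12\|\nabla_\theta\widehat L_{\rm BE}(\theta)\|_2^2\ge c_{\rm BE}\,\widehat L_{\rm BE}(\theta)\qquad\forall\theta\in B_Q.$$
   Context: $\mathcal S$ is a (possibly continuous) state space, $\mathcal A$ a finite action set, $\beta\in(0,1)$, $s\mapsto a_s\in\mathcal A$ a given anchor action map, $Q_\theta:\mathcal S\times\mathcal A\to\mathbb R$ ($\theta\in\mathbb R^{d_\theta}$) a parametrized function, $B_Q\subset\mathbb R^{d_\theta}$ a closed finite-radius ball. $V_Q(s)=\log\sum_{b\in\mathcal A}\exp Q(s,b)$. Grouped empirical Bellman error (from a finite dataset): $\mathcal X_{\rm BE}=\{x_1,\dots,x_B\}$ are the distinct sampled current states at which the anchor action is taken, with empirical weights $\omega_j^{\rm BE}>0$, $\sum_j\omega_j^{\rm BE}=1$, finitely supported empirical next-state probability distributions $\widehat P_j$ on $\mathcal S$, and empirical mean rewards $\widehat r_j\in\mathbb R$; $$\Psi_j(\theta)=\widehat r_j+\beta\sum_y\widehat P_j(y)V_{Q_\theta}(y)-Q_\theta(x_j,a_{x_j}),\qquad\widehat L_{\rm BE}(\theta)=\sum_{j=1}^B\omega_j^{\rm BE}\Psi_j(\theta)^2.$$ $\mathcal X_Q\subset\mathcal S$ is the finite set of all sampled states at which the empirical objective evaluates $Q_\theta$; it contains $\mathcal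 X_{\rm BE}$ and all supports of $\widehat P_j$ (and the states of the likelihood sample). $Z_Q=\mathcal X_Q\times\mathcal A=\{z_1,\dots,z_M\}$; each $\theta\mapsto Q_\theta(z_i)$ is differentiable, and $J_Q(\theta;Z_Q)=D_\theta(Q_\theta(z_1),\dots,Q_\theta(z_M))^\top\in\mathbb R^{M\times d_\theta}$. *)

theory Defs
  imports "HOL-Probability.Probability"
begin

definition gradient :: "('v::real_inner \<Rightarrow> real) \<Rightarrow> 'v \<Rightarrow> 'v" where
  "gradient f x = (THE D. GDERIV f x :> D)"

lemma gradient_eqI:
  assumes "GDERIV f x :> D"
  shows "gradient f x = D"
  unfolding gradient_def
proof (rule the_equality)
  fix D' assume "GDERIV f x :> D'"
  with assms have "(\<lambda>h. inner h D') = (\<lambda>h. inner h D)"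
    unfolding gderiv_def by (rule has_derivative_unique[rotated])
  then have "inner (D' - D) D' = inner (D' - D) D" by metis
  then show "D' = D" by (simp add: inner_diff_right flip: right_minus_eq[of D' D] inner_eq_zero_iff)
qed (fact assms)

definition pos_semidef :: "real ^ 'n ^ 'n \<Rightarrow> bool" where
  "pos_semidef A \<longleftrightarrow> transpose A = A \<and> (\<forall>v. 0 \<le> v \<bullet> (A *v v))"

definition loewner_ge :: "real ^ 'n ^ 'n \<Rightarrow> real ^ 'n ^ 'n \<Rightarrow> bool" (infix \<open>\<succeq>\<close> 50) where
  "A \<succeq> B \<longleftrightarrow> pos_semidef (A - B)"

definition soft_value :: "('s \<Rightarrow> 'a::finite \<Rightarrow> real) \<Rightarrow> 's \<Rightarrow> real" where
  "soft_value q s = ln (\<Sum>b\<in>UNIV. exp (q s b))"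

text \<open>The grouped data are the current states \<open>x j\<close>, next-state distributions \<open>P j\<close> and mean
  rewards \<open>r j\<close>. The sum over next states ranges over the support of \<open>P j\<close>, which is assumed
  finite wherever this is used.\<close>

definition bellman_residual ::
  "real \<Rightarrow> ('s \<Rightarrow> 'a::finite) \<Rightarrow> (nat \<Rightarrow> 's) \<Rightarrow> (nat \<Rightarrow> 's pmf) \<Rightarrow> (nat \<Rightarrow> real) \<Rightarrow>
    ('p \<Rightarrow> 's \<Rightarrow> 'a \<Rightarrow> real) \<Rightarrow> nat \<Rightarrow> 'p \<Rightarrow> real" where
  "bellman_residual \<beta> anchor x P r Q j \<theta> =
     r j + \<beta> * (\<Sum>y\<in>set_pmf (P j). pmf (P j) y * soft_value (Q \<theta>) y) - Q \<theta> (x j) (anchor (x j))"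

definition bellman_error ::
  "real \<Rightarrow> ('s \<Rightarrow> 'a::finite) \<Rightarrow> nat \<Rightarrow> (nat \<Rightarrow> real) \<Rightarrow> (nat \<Rightarrow> 's) \<Rightarrow> (nat \<Rightarrow> 's pmf) \<Rightarrow> (nat \<Rightarrow> real) \<Rightarrow>
    ('p \<Rightarrow> 's \<Rightarrow> 'a \<Rightarrow> real) \<Rightarrow> 'p \<Rightarrow> real" where
  "bellman_error \<beta> anchor B \<omega> x P r Q \<theta> =
     (\<Sum>j=1..B. \<omega> j * (bellman_residual \<beta> anchor x P r Q j \<theta>)\<^sup>2)"

text \<open>A finite list of \<open>M\<close> state-action pairs is a family indexed by a finite type \<open>'m\<close>
  with \<open>CARD('m) = M\<close>, so that the Jacobian is an \<open>M \<times> d\<close> matrix of type \<open>real ^ 'd ^ 'm\<close>.\<close>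

definition Q_jacobian ::
  "(real ^ 'd \<Rightarrow> 's \<Rightarrow> 'a \<Rightarrow> real) \<Rightarrow> ('m::finite \<Rightarrow> 's \<times> 'a) \<Rightarrow> real ^ 'd \<Rightarrow> real ^ 'd ^ 'm" where
  "Q_jacobian Q z \<theta> = jacobian (\<lambda>\<eta>. \<chi> i. Q \<eta> (fst (z i)) (snd (z i))) (at \<theta>)"

end

theory Submission
  imports Defs
begin

text \<open>By the chain rule the gradient of the Bellman error is \<open>J\<^sup>T v\<close> with
  \<open>v = 2 (\<Sum>j. \<omega>\<^sub>j \<Psi>\<^sub>j w\<^sub>j)\<close>, where \<open>w\<^sub>j = \<beta> p\<^sub>j - e\<^sub>j\<close> for a probability vector \<open>p\<^sub>j\<close> on the
  state-action pairs and the unit vector \<open>e\<^sub>j\<close> of the pair \<open>(x\<^sub>j, a\<^bsub>x\<^sub>j\<^esub>)\<close>. The Jacobian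
  assumption gives \<open>\<parallel>J\<^sup>T v\<parallel>\<^sup>2 \<ge> \<mu> \<parallel>v\<parallel>\<^sup>2\<close>. Since the \<open>x\<^sub>j\<close> are distinct, one can test \<open>v\<close> against
  a vector with entries in \<open>[-1, 1]\<close> that equals \<open>- sgn \<Psi>\<^sub>j\<close> on the state \<open>x\<^sub>j\<close>; because
  \<open>\<beta> < 1\<close> the \<open>p\<^sub>j\<close> cannot cancel this, and \<open>\<surd>M \<parallel>v\<parallel> \<ge> 2 (1 - \<beta>) (\<Sum>j. \<omega>\<^sub>j \<bar>\<Psi>\<^sub>j\<bar>)\<close>.\<close>

definition softmax :: "('a::finite \<Rightarrow> real) \<Rightarrow> 'a \<Rightarrow> real" where
  "softmax q b = exp (q b) / (\<Sum>c\<in>UNIV. exp (q c))"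

lemma sum_exp_pos: "(\<Sum>c\<in>UNIV. exp (q (c::'a::finite) :: real)) > 0"
  by (simp add: sum_pos)

lemma sum_softmax: "(\<Sum>b\<in>UNIV. softmax q b) = 1"
  using sum_exp_pos[of q] by (simp add: softmax_def flip: sum_divide_distrib)

text \<open>The family \<open>e\<close> is kept abstract because three instances occur: gradients of
  \<open>Q\<close> give the gradient of the residual, unit vectors give the coefficient vector that
  multiplies the transposed Jacobian, and scalars arise when that vector is tested.\<close>

definition residual_direction ::
  "real \<Rightarrow> ('s \<Rightarrow> 'a::finite) \<Rightarrow> (nat \<Rightarrow> 's) \<Rightarrow> (nat \<Rightarrow> 's pmf) \<Rightarrow> ('s \<Rightarrow> 'a \<Rightarrow> real) \<Rightarrow>
    ('s \<Rightarrow> 'a \<Rightarrow> 'v::real_vector) \<Rightarrow> nat \<Rightarrow> 'v" where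
  "residual_direction \<beta> anchor x P q e j =
     \<beta> *\<^sub>R (\<Sum>y\<in>set_pmf (P j). pmf (P j) y *\<^sub>R (\<Sum>b\<in>UNIV. softmax (q y) b *\<^sub>R e y b))
       - e (x j) (anchor (x j))"

lemma linear_residual_direction:
  assumes "linear T"
  shows "T (residual_direction \<beta> anchor x P q e j)
       = residual_direction \<beta> anchor x P q (\<lambda>y b. T (e y b)) j"
  by (simp add: residual_direction_def linear_diff[OF assms] linear_scale[OF assms]
      linear_sum[OF assms])

text \<open>The derivative of log-sum-exp is the softmax average of the derivatives of its
  arguments.\<close>

lemma GDERIV_soft_value:
  fixes Q :: "'v::real_inner \<Rightarrow> 's \<Rightarrow> 'a::finite \<Rightarrow> real"
  assumes "\<And>b. GDERIV (\<lambda>\<eta>. Q \<eta> y b) \<theta> :> D b"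
  shows "GDERIV (\<lambda>\<eta>. soft_value (Q \<eta>) y) \<theta> :> (\<Sum>b\<in>UNIV. softmax (Q \<theta> y) b *\<^sub>R D b)"
proof -
  have "((\<lambda>\<eta>. \<Sum>b\<in>UNIV. exp (Q \<eta> y b)) has_derivative
         (\<lambda>h. \<Sum>b\<in>UNIV. exp (Q \<theta> y b) * (h \<bullet> D b))) (at \<theta>)"
    using assms unfolding gderiv_def
    by (intro has_derivative_sum) (auto intro!: derivative_eq_intros)
  from has_derivative_ln[OF sum_exp_pos this] show ?thesis
    unfolding gderiv_def soft_value_def
    by (simp add: softmax_def inner_sum_right sum_divide_distrib field_simps sum_distrib_left)
qed

text \<open>Gradients are required only at states that the residual visits, since \<open>Q\<close>
  is known to be differentiable only on the sampled pairs.\<close>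

lemma GDERIV_bellman_residual:
  fixes Q :: "'v::real_inner \<Rightarrow> 's \<Rightarrow> 'a::finite \<Rightarrow> real"
  assumes "\<And>y b. y \<in> insert (x j) (set_pmf (P j)) \<Longrightarrow> GDERIV (\<lambda>\<eta>. Q \<eta> y b) \<theta> :> D y b"
  shows "GDERIV (bellman_residual \<beta> anchor x P r Q j) \<theta> :>
           residual_direction \<beta> anchor x P (Q \<theta>) D j"
proof -
  have S: "((\<lambda>\<eta>. soft_value (Q \<eta>) y) has_derivative
      (\<lambda>h. h \<bullet> (\<Sum>b\<in>UNIV. softmax (Q \<theta> y) b *\<^sub>R D y b))) (at \<theta>)" if "y \<in> set_pmf (P j)" for y
    using GDERIV_soft_value[of Q y \<theta> "D y"] assms that by (auto simp: gderiv_def)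
  have V: "((\<lambda>\<eta>. \<Sum>y\<in>set_pmf (P j). pmf (P j) y * soft_value (Q \<eta>) y) has_derivative
      (\<lambda>h. \<Sum>y\<in>set_pmf (P j). pmf (P j) y * (h \<bullet> (\<Sum>b\<in>UNIV. softmax (Q \<theta> y) b *\<^sub>R D y b)))) (at \<theta>)"
    by (intro has_derivative_sum has_derivative_mult_right S)
  have "((\<lambda>\<eta>. Q \<eta> (x j) (anchor (x j))) has_derivative
      (\<lambda>h. h \<bullet> D (x j) (anchor (x j)))) (at \<theta>)"
    using assms by (auto simp: gderiv_def)
  from has_derivative_diff[OF has_derivative_add[OF has_derivative_const[of "r j"]
        has_derivative_mult_right[OF V, of \<beta>]] this]
  show ?thesis
    unfolding gderiv_def bellman_residual_def[abs_def] residual_direction_def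
    by (simp add: inner_diff_right inner_sum_right)
qed

lemma GDERIV_bellman_error:
  fixes Q :: "'v::real_inner \<Rightarrow> 's \<Rightarrow> 'a::finite \<Rightarrow> real"
  assumes "\<And>j y b. j \<in> {1..B} \<Longrightarrow> y \<in> insert (x j) (set_pmf (P j)) \<Longrightarrow>
    GDERIV (\<lambda>\<eta>. Q \<eta> y b) \<theta> :> D y b"
  shows "GDERIV (bellman_error \<beta> anchor B \<omega> x P r Q) \<theta> :>
    2 *\<^sub>R (\<Sum>j=1..B. (\<omega> j * bellman_residual \<beta> anchor x P r Q j \<theta>)
                      *\<^sub>R residual_direction \<beta> anchor x P (Q \<theta>) D j)"
proof -
  let ?\<Psi> = "bellman_residual \<beta> anchor x P r Q"
  have *: "((\<lambda>\<eta>. \<omega> j * (?\<Psi> j \<eta>)\<^sup>2) has_derivative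
      (\<lambda>h. h \<bullet> (2 *\<^sub>R ((\<omega> j * ?\<Psi> j \<theta>) *\<^sub>R residual_direction \<beta> anchor x P (Q \<theta>) D j)))) (at \<theta>)"
    if "j \<in> {1..B}" for j
  proof -
    have "(?\<Psi> j has_derivative (\<lambda>h. h \<bullet> residual_direction \<beta> anchor x P (Q \<theta>) D j)) (at \<theta>)"
      using GDERIV_bellman_residual[of x j P Q \<theta> D \<beta> anchor r] assms[OF that]
      unfolding gderiv_def by blast
    from has_derivative_mult_right[OF has_derivative_power[OF this, of 2], of "\<omega> j"]
    show ?thesis
      by (simp add: mult_ac)
  qed
  show ?thesis
    unfolding gderiv_def bellman_error_def[abs_def] scaleR_right.sum inner_sum_right
    by (intro has_derivative_sum *)
qed

text \<open>The quadratic form of \<open>A ** transpose A\<close> at \<open>v\<close> is the squared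
  norm of \<open>transpose A *v v\<close>.\<close>

lemma norm_transpose_ge:
  fixes A :: "real ^ 'd ^ 'm"
  assumes "A ** transpose A \<succeq> \<mu> *\<^sub>R mat 1"
  shows "\<mu> * (norm v)\<^sup>2 \<le> (norm (transpose A *v v))\<^sup>2"
proof -
  have "0 \<le> v \<bullet> ((A ** transpose A - \<mu> *\<^sub>R mat 1) *v v)"
    using assms by (simp add: loewner_ge_def pos_semidef_def)
  also have "\<dots> = v \<bullet> (A *v (transpose A *v v)) - \<mu> * (v \<bullet> v)"
    by (simp add: matrix_vector_mult_diff_rdistrib matrix_vector_mul_assoc inner_diff_right
        scaleR_matrix_vector_assoc[symmetric]
        del: transpose_matrix_vector)
  also have "v \<bullet> (A *v (transpose A *v v)) = (transpose A *v v) \<bullet> (transpose A *v v)"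
    by (simp add: dot_lmul_matrix[symmetric] transpose_matrix_vector)
  finally show ?thesis
    by (simp add: power2_norm_eq_inner)
qed

text \<open>Softmax weights sum to 1 at each state, so a family constant in the action no longer
  sees \<open>q\<close>. Testing with such families therefore yields bounds that are uniform in the
  parameter.\<close>

lemma residual_direction_statewise:
  fixes \<sigma> :: "'s \<Rightarrow> real"
  shows "residual_direction \<beta> anchor x P q (\<lambda>y b. \<sigma> y) j
       = \<beta> * (\<Sum>y\<in>set_pmf (P j). pmf (P j) y * \<sigma> y) - \<sigma> (x j)"
  by (simp add: residual_direction_def sum_softmax flip: sum_distrib_right)

lemma residual_direction_cong:
  assumes "\<And>y b. y \<in> insert (x j) (set_pmf (P j)) \<Longrightarrow> e y b = e' y b"
  shows "residual_direction \<beta> anchor x P q e j = residual_direction \<beta> anchor x P q e' j"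
  unfolding residual_direction_def using assms by (auto intro!: arg_cong2[of _ _ _ _ "(-)"] sum.cong)

lemma norm_sum_residual_direction_ge:
  fixes z :: "'m::finite \<Rightarrow> 's \<times> 'a::finite"
  assumes \<beta>: "0 \<le> \<beta>" and x: "inj_on x {1..B}"
    and fin: "\<And>j. j \<in> {1..B} \<Longrightarrow> finite (set_pmf (P j))"
    and k: "\<And>j y b. j \<in> {1..B} \<Longrightarrow> y \<in> insert (x j) (set_pmf (P j)) \<Longrightarrow> z (k y b) = (y, b)"
  shows "(1 - \<beta>) * (\<Sum>j=1..B. \<bar>u j\<bar>) \<le>
    sqrt CARD('m) * norm (\<Sum>j=1..B. u j *\<^sub>R residual_direction \<beta> anchor x P q
                                              (\<lambda>y b. axis (k y b) (1::real)) j)"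
    (is "_ \<le> _ * norm ?v")
proof -
  \<comment> \<open>Injectivity of \<open>x\<close> makes \<open>inv_into\<close> recover
    \<open>j\<close> from \<open>x j\<close>. At other states the chosen index is arbitrary, but the
    value is still a sign, hence bounded by 1.\<close>
  define \<sigma> where "\<sigma> y = - sgn (u (inv_into {1..B} x y))" for y
  define s :: "real ^ 'm" where "s = (\<chi> i. \<sigma> (fst (z i)))"
  have \<sigma>1: "\<bar>\<sigma> y\<bar> \<le> 1" for y
    by (simp add: \<sigma>_def abs_sgn_eq)
  have \<sigma>x: "\<sigma> (x j) = - sgn (u j)" if "j \<in> {1..B}" for j
    using x that by (simp add: \<sigma>_def)
  \<comment> \<open>The term at \<open>x j\<close> contributes exactly
    \<open>\<bar>u j\<bar>\<close>. The next-state average of \<sigma> lies in [-1, 1], so the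
    discounted part removes at most \<open>\<beta> * \<bar>u j\<bar>\<close>.\<close>
  have ge: "(1 - \<beta>) * \<bar>u j\<bar> \<le>
    u j * (s \<bullet> residual_direction \<beta> anchor x P q (\<lambda>y b. axis (k y b) (1::real)) j)"
    if j: "j \<in> {1..B}" for j
  proof -
    let ?m = "\<Sum>y\<in>set_pmf (P j). pmf (P j) y * \<sigma> y"
    have "\<bar>?m\<bar> \<le> (\<Sum>y\<in>set_pmf (P j). pmf (P j) y * 1)"
      by (rule order_trans[OF sum_abs sum_mono])
        (auto simp: abs_mult intro!: mult_left_le \<sigma>1)
    also have "\<dots> = 1"
      using fin[OF j] by (simp add: sum_pmf_eq_1)
    finally have "\<bar>u j * (\<beta> * ?m)\<bar> \<le> \<bar>u j\<bar> * \<beta>"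
      using \<beta> by (auto simp: abs_mult intro!: mult_left_mono mult_left_le)
    moreover have "s \<bullet> residual_direction \<beta> anchor x P q (\<lambda>y b. axis (k y b) (1::real)) j
        = residual_direction \<beta> anchor x P q (\<lambda>y b. \<sigma> y) j"
      unfolding linear_residual_direction[OF bounded_linear.linear[OF bounded_linear_inner_right]]
      by (rule residual_direction_cong) (simp add: inner_axis s_def k[OF j])
    moreover have "u j * sgn (u j) = \<bar>u j\<bar>"
      by (simp add: abs_sgn)
    ultimately show ?thesis
      by (simp add: residual_direction_statewise \<sigma>x[OF j] algebra_simps)
  qed
  have "(1 - \<beta>) * (\<Sum>j=1..B. \<bar>u j\<bar>) \<le> s \<bullet> ?v"
    unfolding inner_sum_right sum_distrib_left inner_scaleR_right by (rule sum_mono[OF ge])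
  also have "\<dots> \<le> norm s * norm ?v"
    by (rule norm_cauchy_schwarz)
  also have "norm s \<le> sqrt CARD('m)"
  proof -
    have "(\<Sum>i\<in>UNIV. (s $ i)\<^sup>2) \<le> (\<Sum>i\<in>(UNIV :: 'm set). 1)"
      using \<sigma>1 by (intro sum_mono) (simp add: s_def abs_square_le_1)
    then show ?thesis
      by (simp add: norm_vec_def L2_set_def)
  qed
  finally show ?thesis
    by (simp add: mult_right_mono)
qed

theorem lemma8:
  fixes \<beta> :: real
    and anchor :: "'s \<Rightarrow> 'a::finite"
    and Q :: "real ^ 'd \<Rightarrow> 's \<Rightarrow> 'a \<Rightarrow> real"
    and \<theta>\<^sub>0 :: "real ^ 'd" and R :: real and B\<^sub>Q :: "(real ^ 'd) set"
    and B :: nat and x :: "nat \<Rightarrow> 's" and \<omega> r :: "nat \<Rightarrow> real" and P :: "nat \<Rightarrow> 's pmf"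
    and X\<^sub>Q :: "'s set" and z :: "'m::finite \<Rightarrow> 's \<times> 'a"
  assumes "0 < \<beta>" and "\<beta> < 1"
    and "0 \<le> R" and "B\<^sub>Q = cball \<theta>\<^sub>0 R"
    and "inj_on x {1..B}"
    and "\<And>j. j \<in> {1..B} \<Longrightarrow> \<omega> j > 0" and "(\<Sum>j=1..B. \<omega> j) = 1"
    and "\<And>j. j \<in> {1..B} \<Longrightarrow> finite (set_pmf (P j))"
    and "finite X\<^sub>Q" and "x ` {1..B} \<subseteq> X\<^sub>Q" and "\<And>j. j \<in> {1..B} \<Longrightarrow> set_pmf (P j) \<subseteq> X\<^sub>Q"
    and "bij_betw z UNIV (X\<^sub>Q \<times> UNIV)"
    and "\<And>i \<theta>. (\<lambda>\<eta>. Q \<eta> (fst (z i)) (snd (z i))) differentiable (at \<theta>)"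
    and "\<exists>\<mu>>0. \<forall>\<theta>\<in>B\<^sub>Q. Q_jacobian Q z \<theta> ** transpose (Q_jacobian Q z \<theta>) \<succeq> \<mu> *\<^sub>R mat 1"
  shows "\<exists>c>0. \<forall>\<theta>\<in>B\<^sub>Q.
    1 / 2 * (norm (gradient (bellman_error \<beta> anchor B \<omega> x P r Q) \<theta>))\<^sup>2
      \<ge> c * bellman_error \<beta> anchor B \<omega> x P r Q \<theta>"
proof -
  let ?L = "bellman_error \<beta> anchor B \<omega> x P r Q"
  let ?\<Psi> = "bellman_residual \<beta> anchor x P r Q"
  obtain \<mu> where \<mu>: "\<mu> > 0"
    "\<And>\<theta>. \<theta> \<in> B\<^sub>Q \<Longrightarrow> Q_jacobian Q z \<theta> ** transpose (Q_jacobian Q z \<theta>) \<succeq> \<mu> *\<^sub>R mat 1"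
    using assms(14) by blast
  \<comment> \<open>The position of a pair in the enumeration \<open>z\<close>; meaningful only for
    states in \<open>X\<^sub>Q\<close>.\<close>
  define k where "k y b = inv z (y, b)" for y b
  have zk: "z (k y b) = (y, b)" if "y \<in> X\<^sub>Q" for y b
    unfolding k_def using assms(12) that by (intro f_inv_into_f) (auto simp: bij_betw_def)
  have inX: "y \<in> X\<^sub>Q" if "j \<in> {1..B}" "y \<in> insert (x j) (set_pmf (P j))" for j y
    using that assms(10,11) by blast
  \<comment> \<open>An empty sum could not equal 1; this makes the minimum below a genuine
    one.\<close>
  have "{1..B} \<noteq> {}"
    using assms(7) by force
  define m where "m = Min (\<omega> ` {1..B})"
  have m: "m > 0" "\<And>j. j \<in> {1..B} \<Longrightarrow> m \<le> \<omega> j"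
    using assms(6) \<open>{1..B} \<noteq> {}\<close> by (auto simp: m_def)
  let ?M = "real CARD('m)"
  \<comment> \<open>Half of the 4 from squaring the gradient's factor 2 leaves
    \<open>2 * \<mu>\<close>; \<open>(1 - \<beta>)\<^sup>2 / ?M\<close> comes from the squared
    test-vector bound, and \<open>m\<close> from replacing squared weights by weights.\<close>
  define c where "c = 2 * \<mu> * (1 - \<beta>)\<^sup>2 * m / ?M"
  have "c > 0"
    using \<mu> m assms(2) by (simp add: c_def)
  moreover have "c * ?L \<theta> \<le> 1 / 2 * (norm (gradient ?L \<theta>))\<^sup>2" if \<theta>: "\<theta> \<in> B\<^sub>Q" for \<theta>
  proof -
    let ?J = "Q_jacobian Q z \<theta>"
    let ?w = "residual_direction \<beta> anchor x P (Q \<theta>) (\<lambda>y b. axis (k y b) (1::real))"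
    define v where "v = (\<Sum>j=1..B. (\<omega> j * ?\<Psi> j \<theta>) *\<^sub>R ?w j)"
    have "(\<lambda>\<eta>. \<chi> i. Q \<eta> (fst (z i)) (snd (z i))) differentiable (at \<theta>)"
      using assms(13)
      by (subst differentiable_componentwise_within) (auto simp: Basis_vec_def inner_axis)
    then have J: "((\<lambda>\<eta>. \<chi> i. Q \<eta> (fst (z i)) (snd (z i))) has_derivative (\<lambda>h. ?J *v h)) (at \<theta>)"
      unfolding jacobian_works Q_jacobian_def .
    \<comment> \<open>The gradient of a single sampled value of \<open>Q\<close> is the
      corresponding row of the Jacobian.\<close>
    have D: "GDERIV (\<lambda>\<eta>. Q \<eta> y b) \<theta> :> transpose ?J *v axis (k y b) 1" if "y \<in> X\<^sub>Q" for y b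
    proof -
      have "((\<lambda>\<eta>. Q \<eta> y b) has_derivative (\<lambda>h. (?J *v h) $ k y b)) (at \<theta>)"
        using bounded_linear.has_derivative[OF bounded_linear_vec_nth J, of "k y b"]
        by (simp add: zk[OF that])
      moreover have "(?J *v h) $ k y b = h \<bullet> (transpose ?J *v axis (k y b) 1)" for h
        by (metis cart_eq_inner_axis dot_lmul_matrix inner_commute transpose_matrix_vector)
      ultimately show ?thesis
        by (simp add: gderiv_def)
    qed
    \<comment> \<open>Every summand is a linear image under the transposed Jacobian, which can be
      pulled out of the whole sum.\<close>
    have "gradient ?L \<theta> = transpose ?J *v (2 *\<^sub>R v)"
      using GDERIV_bellman_error[of B x P Q \<theta> "\<lambda>y b. transpose ?J *v axis (k y b) 1"
          \<beta> anchor \<omega> r, OF D[OF inX], THEN gradient_eqI]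
      by (simp add: v_def linear_residual_direction[OF matrix_vector_mul_linear]
          linear_sum[OF matrix_vector_mul_linear] linear_scale[OF matrix_vector_mul_linear])
    then have grad: "4 * \<mu> * (norm v)\<^sup>2 \<le> (norm (gradient ?L \<theta>))\<^sup>2"
      using norm_transpose_ge[OF \<mu>(2)[OF \<theta>], of "2 *\<^sub>R v"] by (simp add: power_mult_distrib)
    have "(1 - \<beta>) * (\<Sum>j=1..B. \<bar>\<omega> j * ?\<Psi> j \<theta>\<bar>) \<le> sqrt ?M * norm v"
      unfolding v_def
      using assms(1,5,8) zk inX by (intro norm_sum_residual_direction_ge[where z = z]) auto
    then have "((1 - \<beta>) * (\<Sum>j=1..B. \<bar>\<omega> j * ?\<Psi> j \<theta>\<bar>))\<^sup>2 \<le> (sqrt ?M * norm v)\<^sup>2"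
      using assms(2) by (intro power_mono) (auto intro!: mult_nonneg_nonneg sum_nonneg)
    then have v: "(1 - \<beta>)\<^sup>2 * (\<Sum>j=1..B. \<bar>\<omega> j * ?\<Psi> j \<theta>\<bar>)\<^sup>2 \<le> ?M * (norm v)\<^sup>2"
      by (simp add: power_mult_distrib)
    have "m * ?L \<theta> \<le> (\<Sum>j=1..B. \<bar>\<omega> j * ?\<Psi> j \<theta>\<bar>\<^sup>2)"
      unfolding bellman_error_def sum_distrib_left
    proof (rule sum_mono)
      fix j assume j: "j \<in> {1..B}"
      have "m * (\<omega> j * (?\<Psi> j \<theta>)\<^sup>2) \<le> \<omega> j * (\<omega> j * (?\<Psi> j \<theta>)\<^sup>2)"
        using m(2)[OF j] assms(6)[OF j] by (intro mult_right_mono) auto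
      then show "m * (\<omega> j * (?\<Psi> j \<theta>)\<^sup>2) \<le> \<bar>\<omega> j * ?\<Psi> j \<theta>\<bar>\<^sup>2"
        by (simp add: power2_eq_square mult_ac)
    qed
    \<comment> \<open>The Euclidean norm is at most the sum of absolute values.\<close>
    also have "\<dots> \<le> (\<Sum>j=1..B. \<bar>\<omega> j * ?\<Psi> j \<theta>\<bar>)\<^sup>2"
      using L2_set_le_sum[of "{1..B}" "\<lambda>j. \<bar>\<omega> j * ?\<Psi> j \<theta>\<bar>"] unfolding L2_set_def
      by (meson abs_ge_zero sqrt_le_D)
    finally have "(1 - \<beta>)\<^sup>2 * (m * ?L \<theta>) \<le> ?M * (norm v)\<^sup>2"
      using v by (meson mult_left_mono order_trans zero_le_power2)
    then have "c * ?L \<theta> \<le> 2 * \<mu> * (norm v)\<^sup>2"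
      using \<mu>(1) by (simp add: c_def field_simps)
    with grad show ?thesis
      by simp
  qed
  ultimately show ?thesis
    by blast
qed

end
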